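(* For every locally compact Hausdorff space $X$ we have $\mathrm{pd}(X)=\mathrm{d}(X)$.
   Context: For a topological space $X$ with topology $\tau_X$, a neighborhood assignment on $X$ is a map $U:X\to\tau_X$ with $x\in U(x)$ for all $x\in X$. A set $A\subseteq X$ pins down $U$ if $A\cap U(x)\neq\emptyset$ for all $x\in X$. The pinning down number $\mathrm{pd}(X)$ is the smallest cardinal $\kappa$ such that every neighborhood assignment on $X$ can be pinned down by a subset of $X$ of size $\kappa$. $\mathrm{d}(X)$ is the density of $X$ (the smallest cardinality of a dense subset). *)

theory Defs
  imports "HOL-Analysis.Analysis"
begin

no_notation elt_set_eq (infix "=o" 50)
unbundle cardinal_syntax

definition neighborhood_assignment :: "'a topology \<Rightarrow> ('a \<Rightarrow> 'a set) \<Rightarrow> bool" where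
  "neighborhood_assignment X U \<longleftrightarrow> (\<forall>x \<in> topspace X. openin X (U x) \<and> x \<in> U x)"

definition pins_down :: "'a topology \<Rightarrow> 'a set \<Rightarrow> ('a \<Rightarrow> 'a set) \<Rightarrow> bool" where
  "pins_down X A U \<longleftrightarrow> A \<subseteq> topspace X \<and> (\<forall>x \<in> topspace X. A \<inter> U x \<noteq> {})"

text \<open>
  Cardinals are the relations \<^term>\<open>\<kappa>\<close> with \<^term>\<open>Card_order \<kappa>\<close>, and are determined only up to
  \<^term>\<open>(=o)\<close>. The properties to which the next definition is applied say that a subset of the
  space of size \<^term>\<open>\<kappa>\<close> exists, so cardinals on the type of points suffice. The choice
  operator picks one representative of the smallest cardinal; the lemmas at the end show that
  there is one in both cases.
\<close>

definition is_least_cardinal :: "('a rel \<Rightarrow> bool) \<Rightarrow> 'a rel \<Rightarrow> bool" where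
  "is_least_cardinal P \<kappa> \<longleftrightarrow>
     Card_order \<kappa> \<and> P \<kappa> \<and> (\<forall>\<mu>. Card_order \<mu> \<and> P \<mu> \<longrightarrow> \<kappa> \<le>o \<mu>)"

definition all_pinned_by_size :: "'a topology \<Rightarrow> 'a rel \<Rightarrow> bool" where
  "all_pinned_by_size X \<kappa> \<longleftrightarrow>
     (\<forall>U. neighborhood_assignment X U \<longrightarrow> (\<exists>A. |A| =o \<kappa> \<and> pins_down X A U))"

definition has_dense_of_size :: "'a topology \<Rightarrow> 'a rel \<Rightarrow> bool" where
  "has_dense_of_size X \<kappa> \<longleftrightarrow>
     (\<exists>D. D \<subseteq> topspace X \<and> X closure_of D = topspace X \<and> |D| =o \<kappa>)"

definition pinning_down_number :: "'a topology \<Rightarrow> 'a rel" where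
  "pinning_down_number X = (SOME \<kappa>. is_least_cardinal (all_pinned_by_size X) \<kappa>)"

definition topological_density :: "'a topology \<Rightarrow> 'a rel" where
  "topological_density X = (SOME \<kappa>. is_least_cardinal (has_dense_of_size X) \<kappa>)"

lemma is_least_cardinal_exists:
  assumes "Card_order \<kappa>" and "P \<kappa>"
  shows "\<exists>\<mu>. is_least_cardinal P \<mu>"
proof -
  let ?R = "{\<mu>. Card_order \<mu> \<and> P \<mu>}"
  have "?R \<noteq> {}" and "\<forall>r \<in> ?R. Card_order r"
    using assms by auto
  from exists_minim_Card_order[OF this] obtain \<mu> where "\<mu> \<in> ?R" and "\<forall>r \<in> ?R. \<mu> \<le>o r" ..
  then have "is_least_cardinal P \<mu>"
    by (simp add: is_least_cardinal_def)
  then show ?thesis ..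
qed

lemma is_least_cardinal_pinning_down_number:
  "is_least_cardinal (all_pinned_by_size X) (pinning_down_number X)"
proof -
  have "pins_down X (topspace X) U" if "neighborhood_assignment X U" for U
    using that by (auto simp: pins_down_def neighborhood_assignment_def)
  moreover have "|topspace X| =o |topspace X|"
    by (rule ordIso_refl[OF card_of_Card_order])
  ultimately have "all_pinned_by_size X |topspace X|"
    unfolding all_pinned_by_size_def by (intro allI impI exI conjI)
  with card_of_Card_order have "\<exists>\<kappa>. is_least_cardinal (all_pinned_by_size X) \<kappa>"
    by (rule is_least_cardinal_exists)
  then show ?thesis
    unfolding pinning_down_number_def by (rule someI_ex)
qed

lemma is_least_cardinal_topological_density:
  "is_least_cardinal (has_dense_of_size X) (topological_density X)"
proof -
  have "|topspace X| =o |topspace X|"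
    by (rule ordIso_refl[OF card_of_Card_order])
  then have "has_dense_of_size X |topspace X|"
    unfolding has_dense_of_size_def by (intro exI[of _ "topspace X"]) simp
  with card_of_Card_order have "\<exists>\<kappa>. is_least_cardinal (has_dense_of_size X) \<kappa>"
    by (rule is_least_cardinal_exists)
  then show ?thesis
    unfolding topological_density_def by (rule someI_ex)
qed

end

theory Submission
  imports Defs "HOL-Algebra.Free_Abelian_Groups"
begin

text \<open>
  Every nonempty open set contains a nonempty open set \<^term>\<open>V\<close> all of whose nonempty open subsets
  have the cardinality of \<^term>\<open>V\<close>, and local compactness gives \<^term>\<open>V\<close> a base with at most
  \<^term>\<open>|V|\<close> members. Distinct points can then be chosen in the members of the base; assigning to
  each chosen point its member yields a neighborhood assignment on \<^term>\<open>V\<close> that is pinned down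
  only by sets dense in \<^term>\<open>V\<close>. Combining these assignments over a maximal disjoint family of such
  sets \<^term>\<open>V\<close> gives one on the whole space that only dense sets pin down.
\<close>

section \<open>Distinct representatives\<close>

text \<open>Transfinite recursion along the well-order \<open>|I|\<close>. Every proper initial
  segment is smaller than \<open>I\<close>, so the values used before \<open>i\<close> cannot
  exhaust \<open>B i\<close>.\<close>

lemma injective_choice:
  assumes "\<And>i. i \<in> I \<Longrightarrow> |I| \<le>o |B i|"
  shows "\<exists>f. inj_on f I \<and> (\<forall>i\<in>I. f i \<in> B i)"
proof -
  have wo: "Well_order |I|"
    using card_of_Well_order .
  have "\<exists>f. \<forall>i. i \<in> I \<longrightarrow> f i \<in> B i - f ` underS |I| i"
  proof (rule dependent_wf_choice[where P = "\<lambda>f i r. i \<in> I \<longrightarrow> r \<in> B i - f ` underS |I| i"])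
    show "wf ( |I| - Id )"
      using wo by (simp add: well_order_on_def)
  next
    fix f g :: "'a \<Rightarrow> 'b" and i r
    assume "\<And>z. (z, i) \<in> |I| - Id \<Longrightarrow> f z = g z"
    then have "f ` underS |I| i = g ` underS |I| i"
      by (intro image_cong) (auto simp: underS_def)
    then show "(i \<in> I \<longrightarrow> r \<in> B i - f ` underS |I| i) = (i \<in> I \<longrightarrow> r \<in> B i - g ` underS |I| i)"
      by simp
  next
    fix f :: "'a \<Rightarrow> 'b" and i
    have "\<exists>r. r \<in> B i - f ` underS |I| i" if "i \<in> I"
    proof (rule ccontr)
      assume "\<not> ?thesis"
      then have "B i \<subseteq> f ` underS |I| i"
        by blast
      then have "|B i| \<le>o |f ` underS |I| i|"
        by (rule card_of_mono1)
      also have "|f ` underS |I| i| \<le>o |underS |I| i|"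
        by (rule card_of_image)
      also have "|underS |I| i| <o |I|"
        using that by (intro card_of_underS) (simp_all add: Field_card_of card_of_Card_order)
      finally show False
        using assms[OF that] not_ordLess_ordLeq by blast
    qed
    then show "\<exists>r. i \<in> I \<longrightarrow> r \<in> B i - f ` underS |I| i"
      by blast
  qed
  then obtain f where f: "\<And>i. i \<in> I \<Longrightarrow> f i \<in> B i - f ` underS |I| i"
    by blast
  have "f i \<noteq> f j" if "i \<in> I" "j \<in> I" "i \<noteq> j" for i j
  proof -
    \<comment> \<open>By totality one index precedes the other, and the value at the later one was
      chosen to avoid the earlier value.\<close>
    have "(i, j) \<in> |I| \<or> (j, i) \<in> |I|"
      using wo that by (auto simp: order_on_defs total_on_def Field_card_of)
    then have "i \<in> underS |I| j \<or> j \<in> underS |I| i"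
      using that by (auto simp: underS_def)
    then show ?thesis
      using f[OF that(1)] f[OF that(2)] by (metis DiffD2 imageI)
  qed
  then show ?thesis
    using f by (intro exI[of _ f]) (auto intro: inj_onI)
qed

section \<open>Small bases from local compactness\<close>

text \<open>The indices are pairs of a point \<open>x\<close> and a finite
  \<open>F \<subseteq> V\<close>; there are \<open>|V|\<close> of them because \<open>V\<close> is
  infinite. The set \<open>B (x, F)\<close> is a neighborhood of \<open>x\<close> with compact hull
  \<open>K x\<close>, cut down by sets \<open>P x y\<close> separating \<open>x\<close> from each
  \<open>y \<in> F\<close>.\<close>

lemma locally_compact_Hausdorff_open_subset_base:
  fixes X :: "'a topology"
  assumes "locally_compact_space X" and "Hausdorff_space X"
    and V: "openin X V" and inf: "infinite V"
  shows "\<exists>(I :: ('a \<times> 'a set) set) B. |I| \<le>o |V| \<and> (\<forall>i\<in>I. openin X (B i) \<and> B i \<subseteq> V \<and> B i \<noteq> {}) \<and>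
    (\<forall>W. openin X W \<and> W \<subseteq> V \<and> W \<noteq> {} \<longrightarrow> (\<exists>i\<in>I. B i \<subseteq> W))"
proof -
  have "neighbourhood_base_of (compactin X) X"
    using assms locally_compact_space_neighbourhood_base by blast
  then have "\<forall>x\<in>V. \<exists>N K. openin X N \<and> compactin X K \<and> x \<in> N \<and> N \<subseteq> K \<and> K \<subseteq> V"
    using V unfolding neighbourhood_base_of by blast
  then obtain N K where NK: "\<And>x. x \<in> V \<Longrightarrow> openin X (N x)" "\<And>x. x \<in> V \<Longrightarrow> compactin X (K x)"
    "\<And>x. x \<in> V \<Longrightarrow> x \<in> N x" "\<And>x. x \<in> V \<Longrightarrow> N x \<subseteq> K x" "\<And>x. x \<in> V \<Longrightarrow> K x \<subseteq> V"
    by metis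
  have sep: "\<exists>P Q. openin X P \<and> openin X Q \<and> x \<in> P \<and> (x \<noteq> y \<longrightarrow> y \<in> Q \<and> disjnt P Q)"
    if "x \<in> V" "y \<in> V" for x y
  proof (cases "x = y")
    case True
    then show ?thesis
      using V that by blast
  next
    case False
    moreover have "x \<in> topspace X" "y \<in> topspace X"
      using V that openin_subset by blast+
    ultimately show ?thesis
      using \<open>Hausdorff_space X\<close> unfolding Hausdorff_space_def by blast
  qed
  have "\<forall>x\<in>V. \<forall>y\<in>V. \<exists>P Q. openin X P \<and> openin X Q \<and> x \<in> P \<and> (x \<noteq> y \<longrightarrow> y \<in> Q \<and> disjnt P Q)"
    using sep by blast
  then have "\<exists>P Q. \<forall>x\<in>V. \<forall>y\<in>V. openin X (P x y) \<and> openin X (Q x y) \<and> x \<in> P x y \<and>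
      (x \<noteq> y \<longrightarrow> y \<in> Q x y \<and> disjnt (P x y) (Q x y))"
    by (simp only: bchoice_iff)
  then obtain P Q where PQ: "\<And>x y. x \<in> V \<Longrightarrow> y \<in> V \<Longrightarrow> openin X (P x y)"
    "\<And>x y. x \<in> V \<Longrightarrow> y \<in> V \<Longrightarrow> openin X (Q x y)"
    "\<And>x y. x \<in> V \<Longrightarrow> y \<in> V \<Longrightarrow> x \<in> P x y"
    "\<And>x y. x \<in> V \<Longrightarrow> y \<in> V \<Longrightarrow> x \<noteq> y \<Longrightarrow> y \<in> Q x y"
    "\<And>x y. x \<in> V \<Longrightarrow> y \<in> V \<Longrightarrow> x \<noteq> y \<Longrightarrow> disjnt (P x y) (Q x y)"
    by blast
  define B where "B = (\<lambda>(x, F). N x \<inter> \<Inter> (P x ` F))"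
  let ?I = "V \<times> Fpow V"
  have "|Fpow V| =o |V|"
    using inf by (rule card_of_Fpow_infinite)
  then have "|?I| =o |V|"
    using card_of_Times_infinite[OF inf] Fpow_not_empty ordIso_iff_ordLeq by blast
  then have "|?I| \<le>o |V|"
    by (rule ordIso_imp_ordLeq)
  moreover have "openin X (B i) \<and> B i \<subseteq> V \<and> B i \<noteq> {}" if "i \<in> ?I" for i
  proof -
    obtain x F where i: "i = (x, F)" "x \<in> V" "finite F" "F \<subseteq> V"
      using \<open>i \<in> ?I\<close> by (auto simp: Fpow_def)
    \<comment> \<open>Including \<open>N x\<close> keeps the intersected family nonempty even when
      \<open>F\<close> is empty.\<close>
    have B: "B i = \<Inter> (insert (N x) (P x ` F))"
      by (simp add: B_def i)
    have "openin X (B i)"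
      unfolding B using NK(1) PQ(1) i by (intro openin_Inter) auto
    moreover have "x \<in> B i"
      unfolding B using NK(3) PQ(3) i by auto
    moreover have "B i \<subseteq> V"
      unfolding B using NK(4,5) i by blast
    ultimately show ?thesis
      by blast
  qed
  moreover have "\<exists>i\<in>?I. B i \<subseteq> W" if W: "openin X W" "W \<subseteq> V" "W \<noteq> {}" for W
  proof -
    obtain x where x: "x \<in> W" "x \<in> V"
      using W by blast
    have "K x - W = K x \<inter> (topspace X - W)"
      using NK(2)[OF x(2)] compactin_subset_topspace by blast
    then have "compactin X (K x - W)"
      using NK(2)[OF x(2)] W(1) by (metis closedin_diff closedin_topspace compact_Int_closedin)
    moreover have "\<forall>S \<in> Q x ` (K x - W). openin X S"
      using PQ(2) NK(5) x by blast
    \<comment> \<open>Since \<open>x \<in> W\<close>, every \<open>y \<in> K x - W\<close> differs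
      from \<open>x\<close>, so \<open>Q x y\<close> contains \<open>y\<close>.\<close>
    moreover have "K x - W \<subseteq> \<Union> (Q x ` (K x - W))"
      using PQ(4) NK(5) x by blast
    ultimately obtain \<F> where \<F>: "finite \<F>" "\<F> \<subseteq> Q x ` (K x - W)" "K x - W \<subseteq> \<Union>\<F>"
      unfolding compactin_def by meson
    then obtain F where F: "F \<subseteq> K x - W" "finite F" "\<F> = Q x ` F"
      by (meson finite_subset_image)
    have "B (x, F) \<subseteq> W"
    proof (rule ccontr)
      assume "\<not> ?thesis"
      then obtain z where z: "z \<in> N x" "\<And>y. y \<in> F \<Longrightarrow> z \<in> P x y" "z \<notin> W"
        by (auto simp: B_def)
      \<comment> \<open>The point \<open>z\<close> lies in \<open>K x - W\<close>, hence in the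
        finite subcover; yet \<open>P x y\<close>, which contains \<open>z\<close>, is disjoint from
        \<open>Q x y\<close>.\<close>
      then obtain y where "y \<in> F" "z \<in> Q x y"
        using \<F>(3) F(3) NK(4) x by blast
      then show False
        using z(2) PQ(5)[of x y] F(1) NK(5) x by (auto simp: disjnt_iff)
    qed
    moreover have "(x, F) \<in> ?I"
      using F NK(5) x by (auto simp: Fpow_def)
    ultimately show ?thesis
      by blast
  qed
  ultimately show ?thesis
    by (intro exI[of _ ?I] exI[of _ B]) blast
qed

section \<open>Bases indexed by points\<close>

text \<open>This is a pi-base of \<open>V\<close> indexed by the points of \<open>V\<close>, except
  that \<open>U x\<close> may leave \<open>V\<close>. A set that meets \<open>U x\<close> for all
  \<open>x \<in> V\<close> meets every nonempty open subset of \<open>V\<close>.\<close>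

definition point_base :: "'a topology \<Rightarrow> 'a set \<Rightarrow> ('a \<Rightarrow> 'a set) \<Rightarrow> bool" where
  "point_base X V U \<longleftrightarrow> (\<forall>x\<in>V. openin X (U x) \<and> x \<in> U x) \<and>
     (\<forall>W. openin X W \<and> W \<subseteq> V \<and> W \<noteq> {} \<longrightarrow> (\<exists>x\<in>V. U x \<subseteq> W))"

text \<open>As \<open>|I| \<le>o |V| \<le>o |B i|\<close>, distinct points
  \<open>f i \<in> B i\<close> can be chosen, and \<open>f i\<close> is assigned
  \<open>B i\<close>.\<close>

lemma point_base_if_small_base:
  assumes V: "openin X V"
    and I: "|I| \<le>o |V|"
    and B: "\<And>i. i \<in> I \<Longrightarrow> openin X (B i)" "\<And>i. i \<in> I \<Longrightarrow> B i \<subseteq> V" "\<And>i. i \<in> I \<Longrightarrow> B i \<noteq> {}"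
    and base: "\<And>W. openin X W \<Longrightarrow> W \<subseteq> V \<Longrightarrow> W \<noteq> {} \<Longrightarrow> \<exists>i\<in>I. B i \<subseteq> W"
    and large: "\<And>W. openin X W \<Longrightarrow> W \<subseteq> V \<Longrightarrow> W \<noteq> {} \<Longrightarrow> |V| \<le>o |W|"
  shows "\<exists>U. point_base X V U"
proof -
  have "|I| \<le>o |B i|" if "i \<in> I" for i
    using I large[OF B(1-3)[OF that]] ordLeq_transitive by blast
  then obtain f where f: "inj_on f I" "\<And>i. i \<in> I \<Longrightarrow> f i \<in> B i"
    using injective_choice[of I B] by blast
  \<comment> \<open>Injectivity of \<open>f\<close> rules out conflicting values; points of
    \<open>V\<close> not chosen receive \<open>V\<close> merely as an open set containing
    them.\<close>
  define U where "U x = (if x \<in> f ` I then B (the_inv_into I f x) else V)" for x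
  have U_f: "U (f i) = B i" if "i \<in> I" for i
    using that f(1) by (simp add: U_def the_inv_into_f_f)
  have "openin X (U x) \<and> x \<in> U x" if "x \<in> V" for x
  proof (cases "x \<in> f ` I")
    case True
    then show ?thesis
      using B(1) f(2) U_f by auto
  next
    case False
    then show ?thesis
      using that V by (simp add: U_def)
  qed
  moreover have "\<exists>x\<in>V. U x \<subseteq> W" if "openin X W" "W \<subseteq> V" "W \<noteq> {}" for W
    using base[OF that] U_f f(2) B(2) by (metis subsetD)
  ultimately show ?thesis
    unfolding point_base_def by blast
qed

text \<open>Take \<open>V\<close> of least cardinality among the nonempty open subsets of
  \<open>W\<close>; then no nonempty open subset of \<open>V\<close> is smaller than
  \<open>V\<close>.\<close>

lemma point_base_within_open:
  fixes X :: "'a topology"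
  assumes X: "locally_compact_space X" "Hausdorff_space X"
    and W: "openin X W" "W \<noteq> {}"
  shows "\<exists>V U. openin X V \<and> V \<noteq> {} \<and> V \<subseteq> W \<and> point_base X V U"
proof -
  let ?R = "card_of ` {V. openin X V \<and> V \<noteq> {} \<and> V \<subseteq> W}"
  have "?R \<noteq> {}" and "\<forall>r \<in> ?R. Card_order r"
    using W by (auto simp: card_of_Card_order)
  from exists_minim_Card_order[OF this] obtain V
    where V: "openin X V" "V \<noteq> {}" "V \<subseteq> W" and min: "\<forall>r \<in> ?R. |V| \<le>o r"
    by blast
  have large: "|V| \<le>o |S|" if "openin X S" "S \<subseteq> V" "S \<noteq> {}" for S
    using min that V(3) by blast
  have "\<exists>U. point_base X V U"
  proof (cases "finite V")
    case True
    \<comment> \<open>A finite set has no proper subset of its own size, so \<open>V\<close> is its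
      only nonempty open subset and the constant assignment works.\<close>
    have "S = V" if "openin X S" "S \<subseteq> V" "S \<noteq> {}" for S
    proof -
      have "card V \<le> card S"
        using large[OF that] that(2) True finite_subset by (metis finite_card_of_iff_card2)
      then show ?thesis
        using True that(2) by (simp add: card_seteq)
    qed
    then have "point_base X V (\<lambda>_. V)"
      using V by (auto simp: point_base_def)
    then show ?thesis
      by blast
  next
    case False
    obtain I :: "('a \<times> 'a set) set" and B where IB: "|I| \<le>o |V|"
      "\<forall>i\<in>I. openin X (B i) \<and> B i \<subseteq> V \<and> B i \<noteq> {}"
      "\<forall>W. openin X W \<and> W \<subseteq> V \<and> W \<noteq> {} \<longrightarrow> (\<exists>i\<in>I. B i \<subseteq> W)"
      using locally_compact_Hausdorff_open_subset_base[OF X V(1) False] by blast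
    show ?thesis
      by (rule point_base_if_small_base[OF V(1) IB(1)]) (use IB(2,3) large in auto)
  qed
  then show ?thesis
    using V by blast
qed

section \<open>Assembling the global assignment\<close>

lemma maximal_disjoint_subfamily:
  obtains \<M> where "\<M> \<subseteq> \<G>" "pairwise disjnt \<M>"
    "\<forall>V\<in>\<G>. V \<noteq> {} \<longrightarrow> (\<exists>M\<in>\<M>. \<not> disjnt M V)"
proof -
  let ?A = "{\<M>. \<M> \<subseteq> \<G> \<and> pairwise disjnt \<M>}"
  have "\<exists>\<M>\<in>?A. \<forall>\<N>\<in>?A. \<M> \<subseteq> \<N> \<longrightarrow> \<N> = \<M>"
  proof (rule subset_Zorn')
    fix \<C>
    assume \<C>: "subset.chain ?A \<C>"
    have "pairwise disjnt (\<Union>\<C>)"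
      using \<C> by (intro pairwise_chain_Union) (auto simp: subset_chain_def chain_subset_def)
    then show "\<Union>\<C> \<in> ?A"
      using \<C> by (auto simp: subset_chain_def)
  qed
  then obtain \<M> where "\<M> \<in> ?A" and max: "\<forall>\<N>\<in>?A. \<M> \<subseteq> \<N> \<longrightarrow> \<N> = \<M>" ..
  then have \<M>: "\<M> \<subseteq> \<G>" "pairwise disjnt \<M>"
    by auto
  have "\<exists>M\<in>\<M>. \<not> disjnt M V" if V: "V \<in> \<G>" "V \<noteq> {}" for V
  proof (rule ccontr)
    assume disj: "\<not> ?thesis"
    then have "pairwise disjnt (insert V \<M>)"
      using \<M>(2) by (auto simp: pairwise_insert disjnt_sym)
    then have "insert V \<M> \<in> ?A"
      using \<M>(1) V(1) by simp
    \<comment> \<open>Being disjoint from all members of \<open>\<M>\<close>, \<open>V\<close> would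
      now be disjoint from itself and hence empty.\<close>
    then have "V \<in> \<M>"
      using max by blast
    with disj V(2) show False
      by auto
  qed
  with \<M> show thesis
    using that by blast
qed

lemma assignment_pinned_only_by_dense_sets:
  assumes X: "locally_compact_space X" "Hausdorff_space X"
  shows "\<exists>U. neighborhood_assignment X U \<and> (\<forall>A. pins_down X A U \<longrightarrow> X closure_of A = topspace X)"
proof -
  let ?\<G> = "{V. openin X V \<and> (\<exists>U. point_base X V U)}"
  obtain \<M> where \<M>: "\<M> \<subseteq> ?\<G>" "pairwise disjnt \<M>"
    and max: "\<forall>V\<in>?\<G>. V \<noteq> {} \<longrightarrow> (\<exists>M\<in>\<M>. \<not> disjnt M V)"
    by (rule maximal_disjoint_subfamily)
  have "\<forall>V\<in>\<M>. \<exists>U. point_base X V U"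
    using \<M>(1) by blast
  then obtain u where u: "\<And>V. V \<in> \<M> \<Longrightarrow> point_base X V (u V)"
    using bchoice by metis
  \<comment> \<open>Disjointness of \<open>\<M>\<close> makes the description unique; points outside
    the union get the whole space.\<close>
  define U where "U x = (if x \<in> \<Union>\<M> then u (THE V. V \<in> \<M> \<and> x \<in> V) x else topspace X)" for x
  have U: "U x = u V x" if "V \<in> \<M>" "x \<in> V" for V x
  proof -
    have "(THE V. V \<in> \<M> \<and> x \<in> V) = V"
      using that \<M>(2) by (intro the_equality) (auto simp: pairwise_def disjnt_iff)
    then show ?thesis
      using that by (auto simp: U_def)
  qed
  have "neighborhood_assignment X U"
    unfolding neighborhood_assignment_def
  proof
    fix x
    assume x: "x \<in> topspace X"
    show "openin X (U x) \<and> x \<in> U x"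
    proof (cases "x \<in> \<Union>\<M>")
      case True
      then obtain V where "V \<in> \<M>" "x \<in> V"
        by blast
      then show ?thesis
        using u U by (simp add: point_base_def)
    next
      case False
      then have "U x = topspace X"
        unfolding U_def by (rule if_not_P)
      then show ?thesis
        using x by simp
    qed
  qed
  moreover have "X closure_of A = topspace X" if A: "pins_down X A U" for A
    unfolding dense_intersects_open
  proof (intro allI impI, elim conjE)
    fix W
    assume W: "openin X W" "W \<noteq> {}"
    \<comment> \<open>Maximality concerns only members of the family, so it is applied to a member
      inside \<open>W\<close> instead of \<open>W\<close> itself.\<close>
    obtain V' where V': "V' \<in> ?\<G>" "V' \<noteq> {}" "V' \<subseteq> W"
      using point_base_within_open[OF X W] by blast
    then obtain V where V: "V \<in> \<M>" "\<not> disjnt V V'"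
      using max by meson
    then have VW: "V \<inter> W \<noteq> {}"
      using V'(3) by (auto simp: disjnt_def)
    have "openin X (V \<inter> W)"
      using V(1) \<M>(1) W(1) by blast
    then obtain x where x: "x \<in> V" "u V x \<subseteq> V \<inter> W"
      using u[OF V(1)] VW unfolding point_base_def by (metis inf_le1)
    have "x \<in> topspace X"
      using V(1) \<M>(1) x(1) openin_subset by blast
    then show "A \<inter> W \<noteq> {}"
      using A x(2) U[OF V(1) x(1)] unfolding pins_down_def by blast
  qed
  ultimately show ?thesis
    by blast
qed

theorem theorem2p6:
  fixes X :: "'a topology"
  assumes "locally_compact_space X" and "Hausdorff_space X"
  shows "pinning_down_number X =o topological_density X"
proof -
  have pd: "Card_order (pinning_down_number X)" "all_pinned_by_size X (pinning_down_number X)"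
    "\<And>\<mu>. Card_order \<mu> \<Longrightarrow> all_pinned_by_size X \<mu> \<Longrightarrow> pinning_down_number X \<le>o \<mu>"
    using is_least_cardinal_pinning_down_number[of X] by (auto simp: is_least_cardinal_def)
  have d: "Card_order (topological_density X)" "has_dense_of_size X (topological_density X)"
    "\<And>\<mu>. Card_order \<mu> \<Longrightarrow> has_dense_of_size X \<mu> \<Longrightarrow> topological_density X \<le>o \<mu>"
    using is_least_cardinal_topological_density[of X] by (auto simp: is_least_cardinal_def)
  obtain D where D: "D \<subseteq> topspace X" "X closure_of D = topspace X" "|D| =o topological_density X"
    using d(2) unfolding has_dense_of_size_def by blast
  \<comment> \<open>A dense set meets every nonempty open set, hence pins down every
    assignment.\<close>
  have "pins_down X D U" if "neighborhood_assignment X U" for U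
    using that D(1,2) unfolding pins_down_def neighborhood_assignment_def dense_intersects_open
    by blast
  then have "all_pinned_by_size X (topological_density X)"
    using D(3) unfolding all_pinned_by_size_def by blast
  then have "pinning_down_number X \<le>o topological_density X"
    using pd(3) d(1) by blast
  \<comment> \<open>Conversely, a set of size \<open>pinning_down_number X\<close> pinning down this
    special \<open>U\<close> is dense.\<close>
  moreover obtain U where "neighborhood_assignment X U"
    and U: "\<And>A. pins_down X A U \<Longrightarrow> X closure_of A = topspace X"
    using assignment_pinned_only_by_dense_sets[OF assms] by blast
  then obtain A where "|A| =o pinning_down_number X" "pins_down X A U"
    using pd(2) unfolding all_pinned_by_size_def by blast
  then have "has_dense_of_size X (pinning_down_number X)"
    using U unfolding has_dense_of_size_def pins_down_def by blast
  then have "topological_density X \<le>o pinning_down_number X"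
    using d(3) pd(1) by blast
  ultimately show ?thesis
    by (simp add: ordIso_iff_ordLeq)
qed

end
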